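(* Let $M$ be a contact manifold of dimension $2\ell+1$, $\ell\ge 1$, with contact tensor field $\Theta$. If $g$ and $\tilde g$ are two pseudo-Riemannian metrics on $M$ whose Levi-Civita connections $\nabla$ and $\tilde\nabla$ are projectively equivalent, then $$\nabla\Theta=\tilde\nabla\Theta.$$
   Context: All objects are smooth; summation over repeated indices is understood. A contact manifold is a manifold $M$ of dimension $2\ell+1$ with a completely non-integrable hyperplane distribution $\mathcal D\subset TM$, locally $\mathcal D=\ker\theta$ for a 1-form $\theta$ (a contact form) such that $\mathrm{vol}:=\theta\wedge(d\theta)^\ell$ is nowhere zero. For real $\lambda$, a weighted density of weight $\lambda$ (a $\lambda$-density) is a section of $(\Lambda^{n}T^*M)^{\otimes\lambda}$, $n=\dim M=2\ell+1$; locally it is written $\phi\,\omega^\lambda$, where $\phi$ is a function and $\omega$ is the coordinate volume form. The contact tensor field is the weighted 1-form $\Theta:=\theta\otimes \mathrm{vol}^{-\frac{1}{\ell+1}}$ for a (local) contact form $\theta$; it does not depend on the choice of $\theta$. For an affine connection with Christoffel symbols $\Gamma_{ij}^k$, the covariant derivative acts by $\nabla_i(\beta_j\,dx^j)=(\partial_i\beta_j-\Gamma_{ij}^k\beta_k)\,dx^j$ on 1-forms and by $\nabla_i(\phi\,\omega^\lambda)=(\partial_i\phi-\lambda\Gamma_{ij}^j\phi)\,\omega^\lambda$ on $\lambda$-densities, and is extended to weighted tensor fields by the Leibniz rule; $\nabla(t)=\nabla_i(t)\,dx^i$. Two symmetric affine connections are projectively equivalent if they have the same non-parametrized geodesics;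 equivalently, there is a 1-form $\beta$ with $\tilde\Gamma_{ij}^k=\Gamma_{ij}^k+\delta_j^k\beta_i+\delta_i^k\beta_j$; equivalently, their symbols $\Pi_{ij}^k=\Gamma_{ij}^k-\frac{1}{n+1}(\delta_i^k\Gamma_{lj}^l+\delta_j^k\Gamma_{il}^l)$ coincide.
   Formalization: ∇Θ is taken with the symmetric product dx^i dx^j, so only the symmetrized components of ∇_iΘ_j are equated; the unsymmetrized tensors differ by β_iΘ_j − β_jΘ_i, which is nonzero e.g. for the Euclidean and gnomonic metrics on contact R^3. *)

theory Defs
  imports "HOL-Analysis.Analysis"
begin

section \<open>Smooth functions and manifolds\<close>

definition pd :: "'n::finite \<Rightarrow> (real^'n \<Rightarrow> real) \<Rightarrow> real^'n \<Rightarrow> real" where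
  "pd i f x = frechet_derivative f (at x) (axis i 1)"

definition smooth_on :: "(real^'n::finite) set \<Rightarrow> (real^'n \<Rightarrow> real) \<Rightarrow> bool" where
  "smooth_on S f \<longleftrightarrow> (\<forall>is. \<forall>x\<in>S. foldr pd is f differentiable (at x))"

text \<open>A chart is a pair of its domain and its coordinate map; the values of the coordinate map
  outside the domain are irrelevant.\<close>

type_synonym ('a, 'n) chart = "'a set \<times> ('a \<Rightarrow> real^'n)"

abbreviation cdom :: "('a, 'n::finite) chart \<Rightarrow> 'a set" where "cdom \<equiv> fst"
abbreviation coord :: "('a, 'n::finite) chart \<Rightarrow> 'a \<Rightarrow> real^'n" where "coord \<equiv> snd"

definition cimage :: "('a, 'n::finite) chart \<Rightarrow> 'a set \<Rightarrow> (real^'n) set" where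
  "cimage c W = coord c ` (cdom c \<inter> W)"

definition transition :: "('a, 'n::finite) chart \<Rightarrow> ('a, 'n) chart \<Rightarrow> real^'n \<Rightarrow> real^'n" where
  "transition c c' x = coord c' (inv_into (cdom c) (coord c) x)"

abbreviation transition_jacobian ::
    "('a, 'n::finite) chart \<Rightarrow> ('a, 'n) chart \<Rightarrow> real^'n \<Rightarrow> real^'n^'n" where
  "transition_jacobian c c' x \<equiv> jacobian (transition c c') (at x)"

definition carrier_of :: "('a, 'n::finite) chart set \<Rightarrow> 'a set" where
  "carrier_of A = (\<Union>c\<in>A. cdom c)"

text \<open>The manifold is the open subset \<open>carrier_of A\<close> of the ambient Hausdorff, second countable
  space. The atlas need not be maximal.\<close>

definition smooth_atlas ::
    "('a::{t2_space,second_countable_topology}, 'n::finite) chart set \<Rightarrow> bool" where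
  "smooth_atlas A \<longleftrightarrow>
     (\<forall>c\<in>A. open (cdom c) \<and> open (coord c ` cdom c) \<and>
        homeomorphism (cdom c) (coord c ` cdom c) (coord c) (inv_into (cdom c) (coord c))) \<and>
     (\<forall>c\<in>A. \<forall>c'\<in>A. \<forall>k. smooth_on (cimage c (cdom c')) (\<lambda>x. transition c c' x $ k))"


section \<open>Geometric objects, given by their components in every chart\<close>

text \<open>In all laws below, \<open>transition_jacobian c c' x $ a $ i\<close> is the partial derivative of the
  \<open>a\<close>-th coordinate of \<open>c'\<close> with respect to the \<open>i\<close>-th coordinate of \<open>c\<close>.\<close>

definition one_form_on ::
    "('a, 'n::finite) chart set \<Rightarrow> 'a set \<Rightarrow> (('a, 'n) chart \<Rightarrow> real^'n \<Rightarrow> real^'n) \<Rightarrow> bool" where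
  "one_form_on A W \<theta> \<longleftrightarrow>
     (\<forall>c\<in>A. \<forall>j. smooth_on (cimage c W) (\<lambda>x. \<theta> c x $ j)) \<and>
     (\<forall>c\<in>A. \<forall>c'\<in>A. \<forall>x\<in>cimage c (W \<inter> cdom c').
        \<theta> c x = transpose (transition_jacobian c c' x) *v \<theta> c' (transition c c' x))"

definition pseudo_riemannian_metric ::
    "('a, 'n::finite) chart set \<Rightarrow> (('a, 'n) chart \<Rightarrow> real^'n \<Rightarrow> real^'n^'n) \<Rightarrow> bool" where
  "pseudo_riemannian_metric A g \<longleftrightarrow>
     (\<forall>c\<in>A. \<forall>x\<in>coord c ` cdom c. transpose (g c x) = g c x \<and> invertible (g c x)) \<and>
     (\<forall>c\<in>A. \<forall>i j. smooth_on (coord c ` cdom c) (\<lambda>x. g c x $ i $ j)) \<and>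
     (\<forall>c\<in>A. \<forall>c'\<in>A. \<forall>x\<in>cimage c (cdom c').
        g c x = transpose (transition_jacobian c c' x) ** g c' (transition c c' x)
                  ** transition_jacobian c c' x)"

text \<open>The Christoffel symbol with lower indices \<open>i\<close>, \<open>j\<close> and upper index \<open>k\<close> is
  \<open>\<Gamma> c x $ i $ j $ k\<close>.\<close>

type_synonym ('a, 'n) christoffel = "('a, 'n) chart \<Rightarrow> real^'n \<Rightarrow> real^'n^'n^'n"

definition affine_connection ::
    "('a, 'n::finite) chart set \<Rightarrow> ('a, 'n) christoffel \<Rightarrow> bool" where
  "affine_connection A \<Gamma> \<longleftrightarrow>
     (\<forall>c\<in>A. \<forall>i j k. smooth_on (coord c ` cdom c) (\<lambda>x. \<Gamma> c x $ i $ j $ k)) \<and>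
     (\<forall>c\<in>A. \<forall>c'\<in>A. \<forall>x\<in>cimage c (cdom c'). \<forall>i j a.
        (\<Sum>k\<in>UNIV. \<Gamma> c x $ i $ j $ k * transition_jacobian c c' x $ a $ k) =
          pd i (pd j (\<lambda>y. transition c c' y $ a)) x +
          (\<Sum>b\<in>UNIV. \<Sum>d\<in>UNIV. \<Gamma> c' (transition c c' x) $ b $ d $ a
             * transition_jacobian c c' x $ b $ i * transition_jacobian c c' x $ d $ j))"

definition symmetric_connection ::
    "('a, 'n::finite) chart set \<Rightarrow> ('a, 'n) christoffel \<Rightarrow> bool" where
  "symmetric_connection A \<Gamma> \<longleftrightarrow>
     (\<forall>c\<in>A. \<forall>x\<in>coord c ` cdom c. \<forall>i j. \<Gamma> c x $ i $ j = \<Gamma> c x $ j $ i)"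

definition levi_civita ::
    "('a, 'n::finite) chart set \<Rightarrow> (('a, 'n) chart \<Rightarrow> real^'n \<Rightarrow> real^'n^'n) \<Rightarrow>
     ('a, 'n) christoffel \<Rightarrow> bool" where
  "levi_civita A g \<Gamma> \<longleftrightarrow>
     affine_connection A \<Gamma> \<and> symmetric_connection A \<Gamma> \<and>
     (\<forall>c\<in>A. \<forall>x\<in>coord c ` cdom c. \<forall>m i j.
        pd m (\<lambda>y. g c y $ i $ j) x
          - (\<Sum>k\<in>UNIV. \<Gamma> c x $ m $ i $ k * g c x $ k $ j)
          - (\<Sum>k\<in>UNIV. \<Gamma> c x $ m $ j $ k * g c x $ i $ k) = 0)"


section \<open>Geodesics and projective equivalence\<close>

text \<open>Only twice differentiability is demanded of the curve: solutions of the geodesic equation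
  are automatically smooth.\<close>

definition geodesic ::
    "('a::topological_space, 'n::finite) chart set \<Rightarrow> ('a, 'n) christoffel \<Rightarrow>
     real set \<Rightarrow> (real \<Rightarrow> 'a) \<Rightarrow> bool" where
  "geodesic A \<Gamma> I \<gamma> \<longleftrightarrow>
     open I \<and> is_interval I \<and> continuous_on I \<gamma> \<and> \<gamma> ` I \<subseteq> carrier_of A \<and>
     (\<forall>c\<in>A. \<exists>u. \<forall>t\<in>I. \<gamma> t \<in> cdom c \<longrightarrow>
        ((\<lambda>s. coord c (\<gamma> s)) has_vector_derivative u t) (at t) \<and>
        (u has_vector_derivative
           (\<chi> k. - (\<Sum>i\<in>UNIV. \<Sum>j\<in>UNIV. \<Gamma> c (coord c (\<gamma> t)) $ i $ j $ k * u t $ i * u t $ j)))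
          (at t))"

definition reparametrization :: "real set \<Rightarrow> real set \<Rightarrow> (real \<Rightarrow> real) \<Rightarrow> bool" where
  "reparametrization J I h \<longleftrightarrow>
     open J \<and> is_interval J \<and> open I \<and> is_interval I \<and> bij_betw h J I \<and>
     (\<forall>s\<in>J. (\<forall>m. (deriv ^^ m) h differentiable (at s)) \<and> deriv h s \<noteq> 0)"

definition nonparametrized_geodesic ::
    "('a::topological_space, 'n::finite) chart set \<Rightarrow> ('a, 'n) christoffel \<Rightarrow>
     real set \<Rightarrow> (real \<Rightarrow> 'a) \<Rightarrow> bool" where
  "nonparametrized_geodesic A \<Gamma> I \<gamma> \<longleftrightarrow>
     (\<exists>J h. reparametrization J I h \<and> geodesic A \<Gamma> J (\<lambda>s. \<gamma> (h s)))"

definition projectively_equivalent ::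
    "('a::topological_space, 'n::finite) chart set \<Rightarrow> ('a, 'n) christoffel \<Rightarrow>
     ('a, 'n) christoffel \<Rightarrow> bool" where
  "projectively_equivalent A \<Gamma> \<Gamma>' \<longleftrightarrow>
     (\<forall>I \<gamma>. nonparametrized_geodesic A \<Gamma> I \<gamma> \<longleftrightarrow> nonparametrized_geodesic A \<Gamma>' I \<gamma>)"


section \<open>Contact manifolds\<close>

text \<open>A \<open>p\<close>-form at a point is evaluated at a sequence of tangent vectors and looks only at
  the first \<open>p\<close> entries.\<close>

definition wedge ::
    "nat \<Rightarrow> nat \<Rightarrow> ((nat \<Rightarrow> 'v) \<Rightarrow> real) \<Rightarrow> ((nat \<Rightarrow> 'v) \<Rightarrow> real) \<Rightarrow> (nat \<Rightarrow> 'v) \<Rightarrow> real" where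
  "wedge p q \<alpha> \<beta> v =
     (\<Sum>\<sigma> | \<sigma> permutes {..<p+q}.
        of_int (sign \<sigma>) * \<alpha> (\<lambda>i. v (\<sigma> i)) * \<beta> (\<lambda>i. v (\<sigma> (p + i)))) / (fact p * fact q)"

primrec wedge_power ::
    "nat \<Rightarrow> ((nat \<Rightarrow> 'v) \<Rightarrow> real) \<Rightarrow> nat \<Rightarrow> (nat \<Rightarrow> 'v) \<Rightarrow> real" where
  "wedge_power p \<alpha> 0 = (\<lambda>v. 1)"
| "wedge_power p \<alpha> (Suc m) = wedge p (p * m) \<alpha> (wedge_power p \<alpha> m)"

definition ext_deriv :: "(real^'n::finite \<Rightarrow> real^'n) \<Rightarrow> real^'n \<Rightarrow> (nat \<Rightarrow> real^'n) \<Rightarrow> real" where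
  "ext_deriv \<beta> x v =
     (\<Sum>i\<in>UNIV. \<Sum>j\<in>UNIV. (pd i (\<lambda>y. \<beta> y $ j) x - pd j (\<lambda>y. \<beta> y $ i) x) * v 0 $ i * v 1 $ j)"

text \<open>The coefficient of \<open>\<theta> \<and> (d\<theta>)\<^sup>l\<close> with respect to the coordinate volume form. The
  coordinates are taken in an unspecified order, which only affects the sign.\<close>

definition vol_coeff :: "nat \<Rightarrow> (real^'n::finite \<Rightarrow> real^'n) \<Rightarrow> real^'n \<Rightarrow> real" where
  "vol_coeff l \<theta> x =
     wedge 1 (2 * l) (\<lambda>v. \<theta> x \<bullet> v 0) (wedge_power 2 (ext_deriv \<theta> x) l)
       (\<lambda>i. axis (from_nat_into UNIV i) 1)"

definition hyperplane_distribution ::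
    "('a, 'n::finite) chart set \<Rightarrow> (('a, 'n) chart \<Rightarrow> real^'n \<Rightarrow> (real^'n) set) \<Rightarrow> bool" where
  "hyperplane_distribution A D \<longleftrightarrow>
     (\<forall>c\<in>A. \<forall>x\<in>coord c ` cdom c. subspace (D c x) \<and> dim (D c x) + 1 = CARD('n)) \<and>
     (\<forall>c\<in>A. \<forall>c'\<in>A. \<forall>x\<in>cimage c (cdom c').
        D c' (transition c c' x) = (\<lambda>v. transition_jacobian c c' x *v v) ` D c x)"

definition contact_form_on ::
    "('a::topological_space, 'n::finite) chart set \<Rightarrow> nat \<Rightarrow>
     (('a, 'n) chart \<Rightarrow> real^'n \<Rightarrow> (real^'n) set) \<Rightarrow> 'a set \<Rightarrow>
     (('a, 'n) chart \<Rightarrow> real^'n \<Rightarrow> real^'n) \<Rightarrow> bool" where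
  "contact_form_on A l D W \<theta> \<longleftrightarrow>
     open W \<and> W \<subseteq> carrier_of A \<and> one_form_on A W \<theta> \<and>
     (\<forall>c\<in>A. \<forall>x\<in>cimage c W. D c x = {v. \<theta> c x \<bullet> v = 0} \<and> vol_coeff l (\<theta> c) x \<noteq> 0)"

definition contact_manifold ::
    "('a::{t2_space,second_countable_topology}, 'n::finite) chart set \<Rightarrow> nat \<Rightarrow>
     (('a, 'n) chart \<Rightarrow> real^'n \<Rightarrow> (real^'n) set) \<Rightarrow> bool" where
  "contact_manifold A l D \<longleftrightarrow>
     smooth_atlas A \<and> CARD('n) = 2 * l + 1 \<and> hyperplane_distribution A D \<and>
     (\<forall>p\<in>carrier_of A. \<exists>W \<theta>. p \<in> W \<and> contact_form_on A l D W \<theta>)"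


section \<open>The contact tensor field and its covariant derivative\<close>

text \<open>The weighted 1-form \<open>\<theta> \<otimes> vol\<close> to the power \<open>-1/(l+1)\<close>, as its components with respect to the
  coordinate coframe and the power of the coordinate volume form. The absolute value makes real
  powers meaningful whatever the orientation; accordingly a change of coordinates acts on
  \<open>w\<close>-densities by the power \<open>w\<close> of the modulus of the Jacobian determinant. Rescaling \<open>\<theta>\<close> by a
  function \<open>f\<close> multiplies the result by the locally constant sign of \<open>f\<close>.\<close>

definition contact_tensor ::
    "nat \<Rightarrow> (real^'n::finite \<Rightarrow> real^'n) \<Rightarrow> real^'n \<Rightarrow> real^'n" where
  "contact_tensor l \<theta> x = \<bar>vol_coeff l \<theta> x\<bar> powr (- 1 / (real l + 1)) *\<^sub>R \<theta> x"

text \<open>The components (with index \<open>i\<close> of differentiation and index \<open>j\<close> of the form) of the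
  covariant derivative of a 1-form of weight \<open>w\<close>. The last term comes from the action of the
  connection on \<open>w\<close>-densities, by the Leibniz rule.\<close>

definition nabla_component ::
    "real \<Rightarrow> real^'n^'n^'n \<Rightarrow> (real^'n::finite \<Rightarrow> real^'n) \<Rightarrow> real^'n \<Rightarrow> 'n \<Rightarrow> 'n \<Rightarrow> real" where
  "nabla_component w G \<beta> x i j =
     pd i (\<lambda>y. \<beta> y $ j) x - (\<Sum>k\<in>UNIV. G $ i $ j $ k * \<beta> x $ k)
       - w * (\<Sum>k\<in>UNIV. G $ i $ k $ k) * \<beta> x $ j"

text \<open>The juxtaposition \<open>dx\<^sup>i dx\<^sup>j\<close> in the covariant derivative \<open>\<nabla>\<^sub>i \<Theta>\<^sub>j dx\<^sup>i dx\<^sup>j\<close> is the product of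
  symmetric tensors, as in \<open>g = g\<^sub>i\<^sub>j dx\<^sup>i dx\<^sup>j\<close>; hence the symmetrized components. With the tensor
  product instead, the covariant derivatives of the contact tensor field for projectively
  equivalent connections would differ by the generally nonzero \<open>\<beta> \<and> \<Theta>\<close>.\<close>

definition nabla ::
    "real \<Rightarrow> real^'n^'n^'n \<Rightarrow> (real^'n::finite \<Rightarrow> real^'n) \<Rightarrow> real^'n \<Rightarrow> real^'n^'n" where
  "nabla w G \<beta> x =
     (\<chi> i j. (nabla_component w G \<beta> x i j + nabla_component w G \<beta> x j i) / 2)"

definition nabla_contact_tensor ::
    "nat \<Rightarrow> ('a, 'n::finite) christoffel \<Rightarrow> (('a, 'n) chart \<Rightarrow> real^'n \<Rightarrow> real^'n) \<Rightarrow>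
     ('a, 'n) chart \<Rightarrow> real^'n \<Rightarrow> real^'n^'n" where
  "nabla_contact_tensor l \<Gamma> \<theta> c x =
     nabla (- 1 / (real l + 1)) (\<Gamma> c x) (contact_tensor l (\<theta> c)) x"

end

theory Submission
  imports Defs
begin

text \<open>The geodesic equation has, by the Picard--Lindeloef theorem, a local solution with any initial
  velocity \<open>u\<close> at any point. If this geodesic of \<open>\<Gamma>\<close> is, up to reparametrization, also a geodesic
  of \<open>\<Gamma>'\<close>, then comparing second derivatives shows that \<open>T = \<Gamma> - \<Gamma>'\<close> maps \<open>(u, u)\<close> to a multiple
  of \<open>u\<close>. Polarization gives \<open>T\<^sub>i\<^sub>j\<^sup>k = \<delta>\<^sub>i\<^sup>k \<beta>\<^sub>j + \<delta>\<^sub>j\<^sup>k \<beta>\<^sub>i\<close>. For a 1-form \<open>\<Theta>\<close> of weight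
  \<open>w\<close> this changes \<open>\<nabla>\<^sub>i \<Theta>\<^sub>j\<close> by \<open>- \<beta>\<^sub>j \<Theta>\<^sub>i - (1 + w (n + 1)) \<beta>\<^sub>i \<Theta>\<^sub>j\<close>, which is skew when
  \<open>w (n + 1) = - 2\<close>, that is, for \<open>w = - 1 / (l + 1)\<close> and \<open>n = 2 l + 1\<close>.\<close>

section \<open>Local solutions of ordinary differential equations\<close>

text \<open>Picard iteration: the integral operator contracts the complete space of bounded
  continuous functions on the whole line, so it has a fixed point. The global bound \<open>M\<close>
  keeps this fixed point inside the ball.\<close>

lemma lipschitz_ode_solution:
  fixes F :: "'a::banach \<Rightarrow> 'a"
  assumes L: "L-lipschitz_on UNIV F" and M: "\<And>x. norm (F x) \<le> M" and "0 < r"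
  shows "\<exists>e>0. \<exists>y. y 0 = x0 \<and>
    (\<forall>t\<in>{-e<..<e}. y t \<in> cball x0 r \<and> (y has_vector_derivative F (y t)) (at t))"
proof -
  have "0 \<le> L" using L by (rule lipschitz_on_nonneg)
  have "0 \<le> M" using M[of 0] norm_ge_zero[of "F 0"] by linarith
  \<comment> \<open>The two bounds serve \<open>3 * e * L \<le> 1 / 2\<close> (contraction) and
    \<open>3 * e * M \<le> r\<close> (staying in the ball). The summand 1 keeps the denominators
    positive when \<open>L\<close> or \<open>M\<close> is 0.\<close>
  define e where "e = min (1 / (6 * (L + 1))) (r / (3 * (M + 1)))"
  have "0 < e" using \<open>0 \<le> L\<close> \<open>0 \<le> M\<close> \<open>0 < r\<close> by (simp add: e_def)
  have "e \<le> 1 / (6 * (L + 1))" "e \<le> r / (3 * (M + 1))" by (simp_all add: e_def)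
  then have "6 * e * L + 6 * e \<le> 1" "3 * e * M + 3 * e \<le> r"
    using \<open>0 \<le> L\<close> \<open>0 \<le> M\<close> by (simp_all add: field_simps)
  then have eL: "3 * e * L \<le> 1 / 2" and eM: "3 * e * M \<le> r" using \<open>0 < e\<close> by linarith+
  \<comment> \<open>The integral of \<open>z\<close> from 0 to \<open>t\<close>, with
    \<open>t\<close> clamped to \<open>{-e..e}\<close> so that the result is bounded on the whole
    line. Starting both integrals at \<open>-e\<close> gives the right sign for negative
    \<open>t\<close>. Their lengths, at most \<open>2 * e\<close> and \<open>e\<close>, explain the
    factor \<open>3 * e\<close> below.\<close>
  define P where "P z t = integral {-e..max (-e) (min e t)} z - integral {-e..0} z"
    for z :: "real \<Rightarrow> 'a" and t
  have P_le: "norm (P z t) \<le> 3 * e * B"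
    if z: "continuous_on UNIV z" and B: "\<And>s. norm (z s) \<le> B" for z t B
  proof -
    have "0 \<le> B" using B[of 0] norm_ge_zero[of "z 0"] by linarith
    have "continuous_on {a..b} z" for a b using z continuous_on_subset by blast
    then have "norm (integral {-e..max (-e) (min e t)} z) \<le> B * (max (-e) (min e t) - (-e))"
      and "norm (integral {-e..0} z) \<le> B * (0 - (-e))"
      using B \<open>0 < e\<close> by (intro integral_bound; simp)+
    moreover have "B * (max (-e) (min e t) - (-e)) \<le> B * (2 * e)"
      using \<open>0 \<le> B\<close> \<open>0 < e\<close> by (intro mult_left_mono) auto
    moreover have "norm (P z t) \<le> norm (integral {-e..max (-e) (min e t)} z) + norm (integral {-e..0} z)"
      unfolding P_def by (rule norm_triangle_ineq4)
    moreover have "B * (2 * e) + B * (0 - (-e)) = 3 * e * B" by algebra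
    ultimately show ?thesis by linarith
  qed
  have P_cont: "continuous_on UNIV (P z)" if z: "continuous_on UNIV z" for z
  proof -
    have "continuous_on {-e..e} (\<lambda>u. integral {-e..u} z)"
      using z by (intro indefinite_integral_continuous_1 integrable_continuous_real)
        (rule continuous_on_subset, auto)
    then have "continuous_on UNIV (\<lambda>t. integral {-e..max (-e) (min e t)} z)"
      by (rule continuous_on_compose2) (use \<open>0 < e\<close> in \<open>auto intro!: continuous_intros\<close>)
    then show ?thesis unfolding P_def by (intro continuous_intros)
  qed
  have F_cont: "continuous_on UNIV (\<lambda>s. F (apply_bcontfun y s))" for y :: "real \<Rightarrow>\<^sub>C 'a"
    by (rule continuous_on_compose2[OF lipschitz_on_continuous_on[OF L]]) auto
  define T where "T y = Bcontfun (\<lambda>t. x0 + P (\<lambda>s. F (apply_bcontfun y s)) t)" for y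
  have T: "apply_bcontfun (T y) t = x0 + P (\<lambda>s. F (apply_bcontfun y s)) t" for y t
  proof -
    have "norm (x0 + P (\<lambda>s. F (apply_bcontfun y s)) t) \<le> norm x0 + 3 * e * M" for t
      using norm_triangle_le[OF add_left_mono[OF P_le[OF F_cont M]]] .
    then have "(\<lambda>t. x0 + P (\<lambda>s. F (apply_bcontfun y s)) t) \<in> bcontfun"
      by (intro bcontfun_normI continuous_intros P_cont F_cont)
    then show ?thesis by (simp add: T_def Bcontfun_inverse)
  qed
  have "dist (T y) (T y') \<le> (1/2) * dist y y'" for y y'
  proof (rule dist_bound)
    fix t
    define z where "z s = F (apply_bcontfun y s) - F (apply_bcontfun y' s)" for s
    have z: "continuous_on UNIV z" unfolding z_def by (intro continuous_intros F_cont)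
    have "norm (z s) \<le> L * dist y y'" for s
      unfolding z_def dist_norm[symmetric]
      using lipschitz_onD[OF L, of "apply_bcontfun y s" "apply_bcontfun y' s"]
        mult_left_mono[OF dist_bounded[of y s y'] \<open>0 \<le> L\<close>] by auto
    from P_le[OF z this, of t] have "norm (P z t) \<le> 3 * e * L * dist y y'" by (simp add: mult.assoc)
    also have "\<dots> \<le> (1/2) * dist y y'" using eL by (rule mult_right_mono) simp
    also have "P z t = apply_bcontfun (T y) t - apply_bcontfun (T y') t"
      unfolding T z_def P_def
      by (subst (1 2) integral_diff)
        (auto intro!: integrable_continuous_real continuous_on_subset[OF F_cont])
    finally show "dist (apply_bcontfun (T y) t) (apply_bcontfun (T y') t) \<le> (1/2) * dist y y'"
      by (simp add: dist_norm)
  qed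
  then obtain y where "T y = y"
    using banach_fix_type[of "1/2" T] by auto
  define Y where "Y = apply_bcontfun y"
  have Y: "Y t = x0 + P (\<lambda>s. F (Y s)) t" for t
    using T[of y t] \<open>T y = y\<close> by (simp add: Y_def)
  have YF: "continuous_on UNIV (\<lambda>s. F (Y s))" unfolding Y_def by (rule F_cont)
  have "Y 0 = x0" using Y[of 0] \<open>0 < e\<close> by (simp add: P_def)
  moreover have "Y t \<in> cball x0 r" for t
    using Y[of t] P_le[OF YF M, of t] eM by (simp add: dist_norm)
  moreover have "(Y has_vector_derivative F (Y t)) (at t)" if t: "t \<in> {-e<..<e}" for t
  proof -
    have "((\<lambda>u. integral {-e..u} (\<lambda>s. F (Y s))) has_vector_derivative F (Y t)) (at t within {-e..e})"
      using t YF by (intro integral_has_vector_derivative) (auto intro: continuous_on_subset)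
    then have "((\<lambda>u. integral {-e..u} (\<lambda>s. F (Y s))) has_vector_derivative F (Y t)) (at t)"
      using t by (simp add: at_within_Icc_at)
    then have "((\<lambda>u. x0 + (integral {-e..u} (\<lambda>s. F (Y s)) - integral {-e..0} (\<lambda>s. F (Y s))))
        has_vector_derivative F (Y t)) (at t)"
      by (auto intro!: derivative_eq_intros)
    \<comment> \<open>Inside the open interval the clamp is the identity, so \<open>Y\<close>
      coincides there with the indefinite integral just differentiated.\<close>
    moreover have "x0 + (integral {-e..u} (\<lambda>s. F (Y s)) - integral {-e..0} (\<lambda>s. F (Y s))) = Y u"
      if "u \<in> {-e<..<e}" for u
      by (subst (2) Y) (use that in \<open>simp add: P_def\<close>)
    ultimately show ?thesis
      using has_vector_derivative_transform_within_open[OF _ open_greaterThanLessThan t] by blast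
  qed
  ultimately show ?thesis using \<open>0 < e\<close> by blast
qed

text \<open>Precomposing \<open>f\<close> with the nearest-point projection \<open>p\<close> onto
  the ball, which is 1-Lipschitz, makes it Lipschitz and bounded on the whole space. The solution of
  the modified equation stays in the ball, where \<open>p\<close> is the identity, so it solves the
  original one.\<close>

lemma picard_lindelof:
  fixes f :: "'a::euclidean_space \<Rightarrow> 'a"
  assumes "0 < r" and L: "L-lipschitz_on (cball x0 r) f"
  shows "\<exists>e>0. \<exists>y. y 0 = x0 \<and>
    (\<forall>t\<in>{-e<..<e}. y t \<in> cball x0 r \<and> (y has_vector_derivative f (y t)) (at t))"
proof -
  define p where "p = closest_point (cball x0 r)"
  have "cball x0 r \<noteq> {}" using \<open>0 < r\<close> by auto
  then have p: "1-lipschitz_on UNIV p" "\<And>x. p x \<in> cball x0 r"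
    unfolding p_def
    by (auto intro!: lipschitz_onI simp: closest_point_lipschitz closest_point_in_set
        simp del: mem_cball)
  have "compact (f ` cball x0 r)"
    by (intro compact_continuous_image lipschitz_on_continuous_on[OF L] compact_cball)
  then obtain M where "\<forall>y\<in>f ` cball x0 r. norm y \<le> M"
    using compact_imp_bounded bounded_iff by metis
  then have M: "norm (f (p x)) \<le> M" for x using p by blast
  have "L-lipschitz_on UNIV (\<lambda>x. f (p x))"
    using lipschitz_on_compose2[OF p(1) lipschitz_on_subset[OF L, of "range p"]] p(2)
    by (simp add: image_subset_iff)
  from lipschitz_ode_solution[OF this M \<open>0 < r\<close>, of x0] obtain e y where "0 < e" "y 0 = x0"
    and y: "\<And>t. t \<in> {-e<..<e} \<Longrightarrow> y t \<in> cball x0 r \<and> (y has_vector_derivative f (p (y t))) (at t)"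
    by blast
  moreover have "p (y t) = y t" if "t \<in> {-e<..<e}" for t
    using y[OF that] by (simp add: p_def closest_point_self)
  ultimately show ?thesis by metis
qed

section \<open>Closure properties of Lipschitz functions\<close>

text \<open>A Lipschitz function is bounded on a bounded set, so each factor controls the increment
  of the other. Constants are left existential so that these closure rules can be chained on
  polynomial expressions.\<close>

lemma lipschitz_on_mult_exists:
  fixes f g :: "'a::heine_borel \<Rightarrow> real"
  assumes "bounded S" and f: "\<exists>C. C-lipschitz_on S f" and g: "\<exists>C. C-lipschitz_on S g"
  shows "\<exists>C. C-lipschitz_on S (\<lambda>x. f x * g x)"
proof -
  have bd: "\<exists>B. \<forall>x\<in>S. \<bar>h x\<bar> \<le> B" if "C-lipschitz_on S h" for h :: "'a \<Rightarrow> real" and C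
  proof -
    have "bounded (h ` S)"
      using bounded_uniformly_continuous_image[OF lipschitz_on_uniformly_continuous[OF that] \<open>bounded S\<close>] .
    then show ?thesis by (simp add: bounded_iff)
  qed
  obtain C D where C: "C-lipschitz_on S f" and D: "D-lipschitz_on S g" using f g by auto
  obtain B E where B: "\<And>x. x \<in> S \<Longrightarrow> \<bar>f x\<bar> \<le> B" and E: "\<And>x. x \<in> S \<Longrightarrow> \<bar>g x\<bar> \<le> E"
    using bd[OF C] bd[OF D] by blast
  \<comment> \<open>The absolute values keep the constant nonnegative even when \<open>S\<close> is
    empty and \<open>B\<close>, \<open>E\<close> are arbitrary.\<close>
  have "(\<bar>B\<bar> * D + \<bar>E\<bar> * C)-lipschitz_on S (\<lambda>x. f x * g x)"
  proof (rule lipschitz_onI)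
    fix x y assume x: "x \<in> S" and y: "y \<in> S"
    have "f x * g x - f y * g y = f x * (g x - g y) + g y * (f x - f y)" by algebra
    then have "\<bar>f x * g x - f y * g y\<bar> \<le> \<bar>f x\<bar> * \<bar>g x - g y\<bar> + \<bar>g y\<bar> * \<bar>f x - f y\<bar>"
      by (metis abs_mult abs_triangle_ineq)
    also have "\<dots> \<le> \<bar>B\<bar> * (D * dist x y) + \<bar>E\<bar> * (C * dist x y)"
      using lipschitz_onD[OF C x y] lipschitz_onD[OF D x y] B[OF x] E[OF y]
      by (intro add_mono mult_mono) (auto simp: dist_real_def)
    finally show "dist (f x * g x) (f y * g y) \<le> (\<bar>B\<bar> * D + \<bar>E\<bar> * C) * dist x y"
      by (simp add: dist_real_def algebra_simps)
  qed (use lipschitz_on_nonneg[OF C] lipschitz_on_nonneg[OF D] in simp)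
  then show ?thesis by blast
qed

lemma lipschitz_on_sum_exists:
  fixes f :: "'b \<Rightarrow> 'a::metric_space \<Rightarrow> 'c::real_normed_vector"
  assumes "\<And>i. i \<in> I \<Longrightarrow> \<exists>C. C-lipschitz_on S (f i)"
  shows "\<exists>C. C-lipschitz_on S (\<lambda>x. \<Sum>i\<in>I. f i x)"
  using assms
proof (induction I rule: infinite_finite_induct)
  case (insert a I)
  then obtain C D where "C-lipschitz_on S (f a)" "D-lipschitz_on S (\<lambda>x. \<Sum>i\<in>I. f i x)"
    by (metis insertCI)
  from lipschitz_on_add[OF this] insert.hyps show ?case by auto
qed (auto intro: lipschitz_on_constant)

lemma lipschitz_on_vec_lambda_exists:
  fixes f :: "'a::metric_space \<Rightarrow> real^'n::finite"
  assumes "\<And>i. \<exists>C. C-lipschitz_on S (\<lambda>x. f x $ i)"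
  shows "\<exists>C. C-lipschitz_on S f"
proof -
  obtain C where C: "\<And>i. (C i)-lipschitz_on S (\<lambda>x. f x $ i)" using assms by metis
  have "(\<Sum>i\<in>UNIV. C i)-lipschitz_on S f"
  proof (rule lipschitz_onI)
    fix x y assume "x \<in> S" "y \<in> S"
    have "dist (f x) (f y) \<le> (\<Sum>i\<in>UNIV. \<bar>(f x - f y) $ i\<bar>)"
      unfolding dist_norm by (rule norm_le_l1_cart)
    also have "\<dots> \<le> (\<Sum>i\<in>UNIV. C i * dist x y)"
      using lipschitz_onD[OF C \<open>x \<in> S\<close> \<open>y \<in> S\<close>] by (intro sum_mono) (simp add: dist_real_def)
    finally show "dist (f x) (f y) \<le> (\<Sum>i\<in>UNIV. C i) * dist x y" by (simp add: sum_distrib_right)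
  qed (intro sum_nonneg lipschitz_on_nonneg[OF C])
  then show ?thesis by blast
qed

section \<open>Smooth functions\<close>

lemma has_derivative_pd:
  fixes f :: "real^'n::finite \<Rightarrow> real"
  assumes "f differentiable (at x)"
  shows "(f has_derivative (\<lambda>h. \<Sum>i\<in>UNIV. pd i f x * h $ i)) (at x)"
proof -
  have f: "(f has_derivative frechet_derivative f (at x)) (at x)"
    using assms by (simp add: frechet_derivative_works)
  then have "linear (frechet_derivative f (at x))" by (rule has_derivative_linear)
  then have "frechet_derivative f (at x) h = (\<Sum>i\<in>UNIV. pd i f x * h $ i)" for h
    by (subst basis_expansion[of h, symmetric])
      (simp add: linear_sum linear_cmul scalar_mult_eq_scaleR pd_def mult.commute)
  then have "frechet_derivative f (at x) = (\<lambda>h. \<Sum>i\<in>UNIV. pd i f x * h $ i)" by (rule ext)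
  with f show ?thesis by (simp only:)
qed

lemma smooth_on_differentiable: "smooth_on S f \<Longrightarrow> x \<in> S \<Longrightarrow> f differentiable (at x)"
  unfolding smooth_on_def by (metis foldr_Nil id_apply)

lemma smooth_on_pd: "smooth_on S f \<Longrightarrow> smooth_on S (pd i f)"
  unfolding smooth_on_def
proof (intro allI ballI)
  fix js x assume "\<forall>is. \<forall>x\<in>S. foldr pd is f differentiable at x" "x \<in> S"
  \<comment> \<open>\<open>foldr\<close> applies the last list entry first, so appending
    \<open>i\<close> means differentiating by \<open>i\<close> before all of
    \<open>js\<close>.\<close>
  then have "foldr pd (js @ [i]) f differentiable at x" by blast
  then show "foldr pd js (pd i f) differentiable at x" by simp
qed

text \<open>The partial derivatives are continuous, hence bounded on the compact ball. Convexity of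
  the ball turns a bound on the derivative into a Lipschitz constant.\<close>

lemma smooth_on_cball_lipschitz:
  fixes f :: "real^'n::finite \<Rightarrow> real"
  assumes f: "smooth_on S f" and S: "cball x r \<subseteq> S"
  shows "\<exists>C. C-lipschitz_on (cball x r) f"
proof -
  have "\<exists>B. \<forall>z\<in>cball x r. \<bar>pd i f z\<bar> \<le> B" for i
  proof -
    have "continuous_on (cball x r) (pd i f)"
      using smooth_on_differentiable[OF smooth_on_pd[OF f]] S
      by (meson continuous_at_imp_continuous_on differentiable_imp_continuous_within subsetD)
    then have "bounded (pd i f ` cball x r)"
      by (intro compact_imp_bounded compact_continuous_image compact_cball)
    then show ?thesis by (simp add: bounded_iff)
  qed
  then have "\<exists>B. \<forall>i. \<forall>z\<in>cball x r. \<bar>pd i f z\<bar> \<le> B i" by (intro choice allI)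
  then obtain B where B: "\<And>i z. z \<in> cball x r \<Longrightarrow> \<bar>pd i f z\<bar> \<le> B i" by blast
  have "(\<Sum>i\<in>UNIV. \<bar>B i\<bar>)-lipschitz_on (cball x r) f"
  proof (rule bounded_derivative_imp_lipschitz)
    fix z assume z: "z \<in> cball x r"
    with S have "z \<in> S" by blast
    then show "(f has_derivative (\<lambda>h. \<Sum>i\<in>UNIV. pd i f z * h $ i)) (at z within cball x r)"
      by (rule has_derivative_at_withinI[OF has_derivative_pd[OF smooth_on_differentiable[OF f]]])
    have "\<bar>\<Sum>i\<in>UNIV. pd i f z * h $ i\<bar> \<le> (\<Sum>i\<in>UNIV. \<bar>B i\<bar>) * norm h" for h
    proof -
      have "\<bar>\<Sum>i\<in>UNIV. pd i f z * h $ i\<bar> \<le> (\<Sum>i\<in>UNIV. \<bar>pd i f z\<bar> * \<bar>h $ i\<bar>)"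
        by (simp add: order_trans[OF sum_abs] abs_mult)
      also have "\<dots> \<le> (\<Sum>i\<in>UNIV. \<bar>B i\<bar> * norm h)"
        by (intro sum_mono mult_mono order_trans[OF B[OF z] abs_ge_self] component_le_norm_cart) auto
      finally show ?thesis by (simp add: sum_distrib_right)
    qed
    then show "onorm (\<lambda>h. \<Sum>i\<in>UNIV. pd i f z * h $ i) \<le> (\<Sum>i\<in>UNIV. \<bar>B i\<bar>)"
      by (intro onorm_le) simp
  qed (auto intro: sum_nonneg)
  then show ?thesis by blast
qed

section \<open>Componentwise derivatives and the chain rule\<close>

lemma has_vector_derivative_vec_iff:
  fixes f :: "real \<Rightarrow> real^'n::finite"
  shows "(f has_vector_derivative f') (at t) \<longleftrightarrow>
    (\<forall>k. ((\<lambda>s. f s $ k) has_real_derivative f' $ k) (at t))"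
  unfolding has_vector_derivative_def has_field_derivative_def
    has_derivative_componentwise_within[of f] Basis_vec_def
  by (auto simp: inner_axis mult_commute_abs)

lemma has_real_derivative_along_curve:
  fixes f :: "real^'n::finite \<Rightarrow> real"
  assumes "f differentiable (at (X t))" and "(X has_vector_derivative v) (at t)"
  shows "((\<lambda>s. f (X s)) has_real_derivative (\<Sum>i\<in>UNIV. pd i f (X t) * v $ i)) (at t)"
proof -
  have "((\<lambda>s. f (X s)) has_derivative (\<lambda>h. \<Sum>i\<in>UNIV. pd i f (X t) * (h *\<^sub>R v) $ i)) (at t)"
    using has_derivative_compose[of X "\<lambda>h. h *\<^sub>R v" t UNIV f] has_derivative_pd[OF assms(1)] assms(2)
    unfolding has_vector_derivative_def by blast
  moreover have "(\<lambda>h. \<Sum>i\<in>UNIV. pd i f (X t) * (h *\<^sub>R v) $ i) = (*) (\<Sum>i\<in>UNIV. pd i f (X t) * v $ i)"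
    by (simp add: fun_eq_iff sum_distrib_left sum_distrib_right ac_simps)
  ultimately show ?thesis by (simp add: has_field_derivative_def)
qed

text \<open>Links the transformation laws, which are phrased with Jacobian matrices, to the partial
  derivatives produced by the chain rule.\<close>

lemma jacobian_pd:
  fixes f :: "real^'n::finite \<Rightarrow> real^'m::finite"
  assumes "\<And>a. (\<lambda>y. f y $ a) differentiable (at x)"
  shows "jacobian f (at x) $ a $ i = pd i (\<lambda>y. f y $ a) x"
proof -
  have "f differentiable (at x)"
    by (subst differentiable_componentwise_within) (use assms in \<open>auto simp: Basis_vec_def inner_axis\<close>)
  then have "(f has_derivative frechet_derivative f (at x)) (at x)"
    by (simp add: frechet_derivative_works)
  then have "((\<lambda>y. f y $ a) has_derivative (\<lambda>h. frechet_derivative f (at x) h $ a)) (at x)"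
    by (rule bounded_linear.has_derivative[OF bounded_linear_vec_nth])
  from frechet_derivative_at[OF this] show ?thesis
    by (simp add: pd_def jacobian_def matrix_def fun_eq_iff)
qed

section \<open>Existence of geodesics\<close>

text \<open>The right-hand side of the geodesic equation, quadratic in the velocity and linear in
  \<open>G\<close>. Linearity allows it to be evaluated on the difference of two connections as
  well.\<close>

definition acceleration :: "real^'n^'n^'n \<Rightarrow> real^'n::finite \<Rightarrow> real^'n" where
  "acceleration G v = (\<chi> k. - (\<Sum>i\<in>UNIV. \<Sum>j\<in>UNIV. G $ i $ j $ k * v $ i * v $ j))"

text \<open>The second-order equation becomes a first-order system for pairs of position and
  velocity. Its field is polynomial in the velocity with smooth coefficients in the position, hence
  Lipschitz on a closed ball.\<close>

lemma geodesic_ode_solution: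
  fixes G :: "real^'n::finite \<Rightarrow> real^'n^'n^'n"
  assumes G: "\<And>i j k. smooth_on S (\<lambda>x. G x $ i $ j $ k)" and "open S" and "x0 \<in> S"
  shows "\<exists>e>0. \<exists>X V. X 0 = x0 \<and> V 0 = u \<and> (\<forall>t\<in>{-e<..<e}. X t \<in> S \<and>
    (X has_vector_derivative V t) (at t) \<and>
    (V has_vector_derivative acceleration (G (X t)) (V t)) (at t))"
proof -
  obtain r where "0 < r" and r: "cball x0 r \<subseteq> S"
    by (meson \<open>open S\<close> \<open>x0 \<in> S\<close> open_contains_cball_eq)
  define B where "B = cball (x0, u) r"
  define f where "f z = (snd z, acceleration (G (fst z)) (snd z))" for z
  \<comment> \<open>Distances in the product dominate those of the first components, so the same
    radius \<open>r\<close> serves both balls.\<close>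
  have fst_B: "fst ` B \<subseteq> cball x0 r"
    unfolding B_def using order_trans[OF dist_fst_le] by (force simp only: mem_cball fst_conv)
  have "bounded B" unfolding B_def by simp
  have fst_lip: "1-lipschitz_on B fst" and snd_B: "1-lipschitz_on B snd"
    by (intro lipschitz_onI; simp add: dist_fst_le dist_snd_le)+
  have "\<exists>C. C-lipschitz_on B (\<lambda>z. G (fst z) $ i $ j $ k)" for i j k
  proof -
    from smooth_on_cball_lipschitz[OF G r] obtain C
      where "C-lipschitz_on (cball x0 r) (\<lambda>x. G x $ i $ j $ k)" by blast
    from lipschitz_on_compose2[OF fst_lip lipschitz_on_subset[OF this fst_B]] show ?thesis by blast
  qed
  moreover have "\<exists>C. C-lipschitz_on B (\<lambda>z. snd z $ i)" for i
  proof -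
    have "1-lipschitz_on (snd ` B) (\<lambda>v. v $ i)" by (intro lipschitz_onI) (auto simp: dist_vec_nth_le)
    from lipschitz_on_compose2[OF snd_B this] show ?thesis by blast
  qed
  ultimately have "\<exists>C. C-lipschitz_on B
      (\<lambda>z. \<Sum>i\<in>UNIV. \<Sum>j\<in>UNIV. G (fst z) $ i $ j $ k * snd z $ i * snd z $ j)" for k
    by (intro lipschitz_on_sum_exists lipschitz_on_mult_exists \<open>bounded B\<close>)
  then have "\<exists>C. C-lipschitz_on B (\<lambda>z. acceleration (G (fst z)) (snd z))"
    by (intro lipschitz_on_vec_lambda_exists) (simp add: acceleration_def)
  then obtain L where "L-lipschitz_on (cball (x0, u) r) f"
    using lipschitz_on_Pair[OF snd_B] unfolding f_def B_def by blast
  from picard_lindelof[OF \<open>0 < r\<close> this] obtain e y where "0 < e" and y0: "y 0 = (x0, u)"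
    and y: "\<And>t. t \<in> {-e<..<e} \<Longrightarrow> y t \<in> B \<and> (y has_vector_derivative f (y t)) (at t)"
    unfolding B_def by blast
  show ?thesis
  proof (intro exI conjI ballI)
    fix t assume t: "t \<in> {-e<..<e}"
    show "fst (y t) \<in> S" using y[OF t] fst_B r by auto
    show "((\<lambda>t. fst (y t)) has_vector_derivative snd (y t)) (at t)"
      using bounded_linear.has_vector_derivative[OF bounded_linear_fst conjunct2[OF y[OF t]]]
      by (simp add: f_def)
    show "((\<lambda>t. snd (y t)) has_vector_derivative acceleration (G (fst (y t))) (snd (y t))) (at t)"
      using bounded_linear.has_vector_derivative[OF bounded_linear_snd conjunct2[OF y[OF t]]]
      by (simp add: f_def)
  qed (use \<open>0 < e\<close> y0 in auto)
qed

section \<open>Geodesics under changes of chart\<close>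

text \<open>For one fixed new coordinate, \<open>H\<close> is its Hessian, \<open>J\<close> its
  gradient, and \<open>K\<close> the full Jacobian. The left side is its second derivative along a
  geodesic. Inserting the transformation law for \<open>G\<close> cancels the Hessian term and
  leaves \<open>G'\<close> evaluated on the transformed velocity.\<close>

lemma geodesic_acceleration_coordinate_change:
  fixes v :: "'n::finite \<Rightarrow> real"
  assumes "\<And>i j. (\<Sum>k\<in>UNIV. G i j k * J k) = H i j + (\<Sum>b\<in>UNIV. \<Sum>d\<in>UNIV. G' b d * K b i * K d j)"
  shows "(\<Sum>i\<in>UNIV. (\<Sum>m\<in>UNIV. H m i * v m) * v i + J i * - (\<Sum>p\<in>UNIV. \<Sum>q\<in>UNIV. G p q i * v p * v q))
    = - (\<Sum>b\<in>UNIV. \<Sum>d\<in>UNIV. G' b d * (\<Sum>i\<in>UNIV. K b i * v i) * (\<Sum>j\<in>UNIV. K d j * v j))"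
proof -
  have "(\<Sum>i\<in>UNIV. J i * (\<Sum>p\<in>UNIV. \<Sum>q\<in>UNIV. G p q i * v p * v q))
      = (\<Sum>p\<in>UNIV. \<Sum>q\<in>UNIV. (\<Sum>i\<in>UNIV. G p q i * J i) * v p * v q)"
  proof -
    have "(\<Sum>i\<in>UNIV. \<Sum>p\<in>UNIV. \<Sum>q\<in>UNIV. F i p q) = (\<Sum>p\<in>UNIV. \<Sum>q\<in>UNIV. \<Sum>i\<in>UNIV. F i p q)"
      for F :: "'n \<Rightarrow> 'n \<Rightarrow> 'n \<Rightarrow> real"
      by (subst sum.swap) (intro sum.cong refl sum.swap)
    then show ?thesis by (simp add: sum_distrib_left sum_distrib_right ac_simps)
  qed
  also have "\<dots> = (\<Sum>p\<in>UNIV. \<Sum>q\<in>UNIV. H p q * v p * v q)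
     + (\<Sum>p\<in>UNIV. \<Sum>q\<in>UNIV. \<Sum>b\<in>UNIV. \<Sum>d\<in>UNIV. G' b d * K b p * K d q * v p * v q)"
    by (simp add: assms distrib_right sum.distrib sum_distrib_right)
  \<comment> \<open>Treating each double sum as one sum over pairs exchanges all four indices in a
    single swap.\<close>
  also have "(\<Sum>p\<in>UNIV. \<Sum>q\<in>UNIV. \<Sum>b\<in>UNIV. \<Sum>d\<in>UNIV. G' b d * K b p * K d q * v p * v q)
      = (\<Sum>b\<in>UNIV. \<Sum>d\<in>UNIV. \<Sum>p\<in>UNIV. \<Sum>q\<in>UNIV. G' b d * K b p * K d q * v p * v q)"
    using sum.swap[of "\<lambda>(p, q) (b, d). G' b d * K b p * K d q * v p * v q" "UNIV \<times> UNIV" "UNIV \<times> UNIV"]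
    by (simp only: sum.cartesian_product' case_prod_conv)
  also have "\<dots> = (\<Sum>b\<in>UNIV. \<Sum>d\<in>UNIV. G' b d * (\<Sum>i\<in>UNIV. K b i * v i) * (\<Sum>j\<in>UNIV. K d j * v j))"
    by (simp add: sum_distrib_left sum_distrib_right ac_simps)
  also have "(\<Sum>p\<in>UNIV. \<Sum>q\<in>UNIV. H p q * v p * v q) = (\<Sum>i\<in>UNIV. (\<Sum>m\<in>UNIV. H m i * v m) * v i)"
    by (subst sum.swap) (simp add: sum_distrib_right)
  finally show ?thesis by (simp add: sum_subtractf)
qed

lemma open_coord_image:
  assumes "smooth_atlas A" "c \<in> A"
  shows "open (coord c ` cdom c)"
  using assms by (auto simp: smooth_atlas_def)

lemma open_cimage_cdom:
  assumes A: "smooth_atlas A" and "c \<in> A" "c' \<in> A"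
  shows "open (cimage c (cdom c'))"
proof -
  have "open (cdom c)" "open (cdom c')"
    and "homeomorphism (cdom c) (coord c ` cdom c) (coord c) (inv_into (cdom c) (coord c))"
    using assms by (auto simp: smooth_atlas_def)
  then have "openin (top_of_set (coord c ` cdom c)) (coord c ` (cdom c \<inter> cdom c'))"
    by (intro homeomorphism_imp_open_map) auto
  then show ?thesis
    using open_coord_image[OF A \<open>c \<in> A\<close>] by (simp add: cimage_def openin_open_eq)
qed

text \<open>The differential equation is solved in the single chart \<open>c\<close>, whereas
  \<open>geodesic\<close> demands it in every chart that the curve meets. The transformation law of
  the connection carries it over.\<close>

lemma geodesic_from_chart:
  fixes A :: "('a::{t2_space,second_countable_topology}, 'n::finite) chart set"
  assumes A: "smooth_atlas A" and \<Gamma>: "affine_connection A \<Gamma>" and c: "c \<in> A"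
    and I: "open I" "is_interval I"
    and X: "\<And>t. t \<in> I \<Longrightarrow> X t \<in> coord c ` cdom c"
    and XV: "\<And>t. t \<in> I \<Longrightarrow> (X has_vector_derivative V t) (at t)"
    and VG: "\<And>t. t \<in> I \<Longrightarrow> (V has_vector_derivative acceleration (\<Gamma> c (X t)) (V t)) (at t)"
  shows "geodesic A \<Gamma> I (\<lambda>t. inv_into (cdom c) (coord c) (X t))"
  unfolding geodesic_def
proof (intro conjI ballI I)
  let ?\<gamma> = "\<lambda>t. inv_into (cdom c) (coord c) (X t)"
  have hom: "homeomorphism (cdom c) (coord c ` cdom c) (coord c) (inv_into (cdom c) (coord c))"
    using A c by (auto simp: smooth_atlas_def)
  have "continuous_on I X"
    using XV by (meson continuous_at_imp_continuous_on has_vector_derivative_continuous)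
  then show "continuous_on I ?\<gamma>"
    by (rule continuous_on_compose2[OF homeomorphism_cont2[OF hom]]) (use X in blast)
  show "?\<gamma> ` I \<subseteq> carrier_of A"
    using X c by (auto simp: carrier_of_def intro!: inv_into_into bexI[of _ c])
  fix c' assume c': "c' \<in> A"
  define S where "S = cimage c (cdom c')"
  define f where "f a = (\<lambda>y. transition c c' y $ a)" for a
  \<comment> \<open>The velocity in the chart \<open>c'\<close>, as dictated by the chain rule; it
    matters only at times when the curve lies in the domain of \<open>c'\<close>.\<close>
  define u where "u t = (\<chi> a. \<Sum>i\<in>UNIV. pd i (f a) (X t) * V t $ i)" for t
  have "open S" unfolding S_def using A c c' by (rule open_cimage_cdom)
  have f: "smooth_on S (f a)" for a
    using A c c' by (auto simp: smooth_atlas_def S_def f_def)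
  show "\<exists>u. \<forall>t\<in>I. ?\<gamma> t \<in> cdom c' \<longrightarrow>
      ((\<lambda>s. coord c' (?\<gamma> s)) has_vector_derivative u t) (at t) \<and>
      (u has_vector_derivative (\<chi> k. - (\<Sum>i\<in>UNIV. \<Sum>j\<in>UNIV.
         \<Gamma> c' (coord c' (?\<gamma> t)) $ i $ j $ k * u t $ i * u t $ j))) (at t)"
  proof (intro exI ballI impI conjI)
    fix t assume t: "t \<in> I" and "?\<gamma> t \<in> cdom c'"
    then have XS: "X t \<in> S"
      unfolding S_def cimage_def using X[OF t] inv_into_into[OF X[OF t]] f_inv_into_f[OF X[OF t]]
      by (metis IntI image_eqI)
    have J: "transition_jacobian c c' (X t) $ a $ i = pd i (f a) (X t)" for a i
      unfolding f_def
      by (rule jacobian_pd) (use smooth_on_differentiable[OF f XS] in \<open>simp add: f_def\<close>)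
    show "((\<lambda>s. coord c' (?\<gamma> s)) has_vector_derivative u t) (at t)"
      unfolding has_vector_derivative_vec_iff u_def transition_def[symmetric]
      using has_real_derivative_along_curve[OF smooth_on_differentiable[OF f XS] XV[OF t]]
      by (simp add: f_def)
    have law: "(\<Sum>k\<in>UNIV. \<Gamma> c (X t) $ i $ j $ k * pd k (f a) (X t)) = pd i (pd j (f a)) (X t) +
          (\<Sum>b\<in>UNIV. \<Sum>d\<in>UNIV. \<Gamma> c' (transition c c' (X t)) $ b $ d $ a
             * pd i (f b) (X t) * pd j (f d) (X t))" for i j a
    proof -
      have "(\<Sum>k\<in>UNIV. \<Gamma> c (X t) $ i $ j $ k * transition_jacobian c c' (X t) $ a $ k) =
          pd i (pd j (\<lambda>y. transition c c' y $ a)) (X t) +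
          (\<Sum>b\<in>UNIV. \<Sum>d\<in>UNIV. \<Gamma> c' (transition c c' (X t)) $ b $ d $ a
             * transition_jacobian c c' (X t) $ b $ i * transition_jacobian c c' (X t) $ d $ j)"
        using \<Gamma> c c' XS unfolding affine_connection_def S_def by blast
      then show ?thesis unfolding J by (simp only: f_def)
    qed
    \<comment> \<open>The product rule yields a Hessian term and a gradient term, which together
      form the left side of \<open>geodesic_acceleration_coordinate_change\<close>.\<close>
    have "((\<lambda>s. u s $ a) has_real_derivative
        (\<Sum>i\<in>UNIV. (\<Sum>m\<in>UNIV. pd m (pd i (f a)) (X t) * V t $ m) * V t $ i
           + pd i (f a) (X t) * acceleration (\<Gamma> c (X t)) (V t) $ i)) (at t)" for a
    proof -
      have 1: "((\<lambda>s. pd i (f a) (X s)) has_real_derivative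
          (\<Sum>m\<in>UNIV. pd m (pd i (f a)) (X t) * V t $ m)) (at t)" for i
        by (intro has_real_derivative_along_curve XV t
            smooth_on_differentiable[OF smooth_on_pd[OF f] XS])
      have 2: "((\<lambda>s. V s $ i) has_real_derivative acceleration (\<Gamma> c (X t)) (V t) $ i) (at t)" for i
        using VG[OF t] by (simp add: has_vector_derivative_vec_iff)
      show ?thesis
        unfolding u_def by (auto intro!: derivative_eq_intros 1 2 sum.cong)
    qed
    then show "(u has_vector_derivative (\<chi> k. - (\<Sum>i\<in>UNIV. \<Sum>j\<in>UNIV.
         \<Gamma> c' (coord c' (?\<gamma> t)) $ i $ j $ k * u t $ i * u t $ j))) (at t)"
      unfolding has_vector_derivative_vec_iff transition_def[symmetric] u_def
      using geodesic_acceleration_coordinate_change[OF law, where v = "\<lambda>i. V t $ i"]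
      by (simp add: acceleration_def)
  qed
qed

section \<open>Projective equivalence\<close>

text \<open>Makes every geodesic a nonparametrized one. Smoothness is stated through iterates of
  \<open>deriv\<close>; affine functions are closed under \<open>deriv\<close>, which makes being
  affine the induction invariant.\<close>

lemma reparametrization_id:
  assumes "open I" and "is_interval I"
  shows "reparametrization I I (\<lambda>s. s)"
proof -
  have "\<exists>a b. (deriv ^^ m) (\<lambda>s. s) = (\<lambda>s. a * s + b :: real)" for m
  proof (induction m)
    case 0
    have "(deriv ^^ 0) (\<lambda>s. s) = (\<lambda>s. 1 * s + 0 :: real)" by simp
    then show ?case by (intro exI)
  next
    case (Suc m)
    then obtain a b where "(deriv ^^ m) (\<lambda>s. s) = (\<lambda>s. a * s + b :: real)" by blast
    moreover have "deriv (\<lambda>s. a * s + b :: real) = (\<lambda>s. 0 * s + a)"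
      by (intro ext DERIV_imp_deriv) (auto intro!: derivative_eq_intros)
    ultimately have "(deriv ^^ Suc m) (\<lambda>s. s) = (\<lambda>s. 0 * s + a)" by simp
    then show ?case by (intro exI)
  qed
  moreover have "(\<lambda>s. a * s + b) differentiable (at s)" for a b s :: real
    by (intro derivative_intros)
  ultimately have "(deriv ^^ m) (\<lambda>s. s) differentiable (at s)" for m and s :: real
    by metis
  then show ?thesis using assms by (simp add: reparametrization_def bij_betw_id[unfolded id_def])
qed

text \<open>Let \<open>X\<close> be the \<open>\<Gamma>\<close>-geodesic with velocity
  \<open>u\<close> at \<open>x\<close>, and let its reparametrization by \<open>h\<close> be a
  \<open>\<Gamma>'\<close>-geodesic. Computing the second derivative of the latter in two ways
  equates \<open>h'^2 * a + h'' * u\<close> with \<open>h'^2 * a'\<close>, where \<open>a\<close>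
  and \<open>a'\<close> are the two accelerations at \<open>u\<close>. Division by
  \<open>h'^2\<close> gives the multiple \<open>- h'' / h'^2\<close>.\<close>

lemma projectively_equivalent_acceleration:
  fixes A :: "('a::{t2_space,second_countable_topology}, 'n::finite) chart set"
  assumes A: "smooth_atlas A" and \<Gamma>: "affine_connection A \<Gamma>"
    and pe: "projectively_equivalent A \<Gamma> \<Gamma>'"
    and c: "c \<in> A" and x: "x \<in> coord c ` cdom c"
  shows "\<exists>\<mu>. acceleration (\<Gamma> c x) u - acceleration (\<Gamma>' c x) u = \<mu> *\<^sub>R u"
proof -
  have "smooth_on (coord c ` cdom c) (\<lambda>x. \<Gamma> c x $ i $ j $ k)" for i j k
    using \<Gamma> c by (auto simp: affine_connection_def)
  from geodesic_ode_solution[where u = u, OF this open_coord_image[OF A c] x]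
  obtain e X V where "0 < e" and X0: "X 0 = x" and V0: "V 0 = u"
    and X: "\<And>t. t \<in> {-e<..<e} \<Longrightarrow> X t \<in> coord c ` cdom c"
    and XV: "\<And>t. t \<in> {-e<..<e} \<Longrightarrow> (X has_vector_derivative V t) (at t)"
    and VG: "\<And>t. t \<in> {-e<..<e} \<Longrightarrow>
      (V has_vector_derivative acceleration (\<Gamma> c (X t)) (V t)) (at t)"
    by blast
  define I where "I = {-e<..<e}"
  define \<gamma> where "\<gamma> t = inv_into (cdom c) (coord c) (X t)" for t
  have I: "open I" "is_interval I" by (simp_all add: I_def)
  have "geodesic A \<Gamma> I \<gamma>"
    unfolding \<gamma>_def using geodesic_from_chart[OF A \<Gamma> c I] X XV VG unfolding I_def by blast
  then have "nonparametrized_geodesic A \<Gamma> I \<gamma>"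
    unfolding nonparametrized_geodesic_def using reparametrization_id[OF I] by blast
  then have "nonparametrized_geodesic A \<Gamma>' I \<gamma>"
    using pe by (simp add: projectively_equivalent_def)
  then obtain J h where h: "reparametrization J I h" and geo: "geodesic A \<Gamma>' J (\<lambda>s. \<gamma> (h s))"
    unfolding nonparametrized_geodesic_def by blast
  have J: "open J" and hJ: "h ` J = I"
    using h by (auto simp: reparametrization_def bij_betw_def)
  have \<gamma>: "\<gamma> t \<in> cdom c" "coord c (\<gamma> t) = X t" if "t \<in> I" for t
    using X[of t] that by (auto simp: I_def \<gamma>_def inv_into_into f_inv_into_f)
  obtain w where w:
    "\<And>s. s \<in> J \<Longrightarrow> ((\<lambda>s. coord c (\<gamma> (h s))) has_vector_derivative w s) (at s)"
    "\<And>s. s \<in> J \<Longrightarrow> (w has_vector_derivative acceleration (\<Gamma>' c (X (h s))) (w s)) (at s)"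
  proof -
    from geo c obtain w where "\<forall>s\<in>J. \<gamma> (h s) \<in> cdom c \<longrightarrow>
        ((\<lambda>s. coord c (\<gamma> (h s))) has_vector_derivative w s) (at s) \<and>
        (w has_vector_derivative acceleration (\<Gamma>' c (coord c (\<gamma> (h s)))) (w s)) (at s)"
      unfolding geodesic_def acceleration_def by meson
    then show thesis using that \<gamma> hJ by (metis imageI)
  qed
  have h': "(h has_real_derivative deriv h s) (at s)"
    and h'': "(deriv h has_real_derivative deriv (deriv h) s) (at s)"
    and h'_nz: "deriv h s \<noteq> 0" if "s \<in> J" for s
  proof -
    have "(deriv ^^ m) h differentiable (at s)" for m
      using h that by (simp add: reparametrization_def)
    from this[of 0] this[of 1] show "(h has_real_derivative deriv h s) (at s)"
      "(deriv h has_real_derivative deriv (deriv h) s) (at s)"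
      by (simp_all add: DERIV_deriv_iff_real_differentiable)
    show "deriv h s \<noteq> 0" using h that by (simp add: reparametrization_def)
  qed
  \<comment> \<open>Both sides are the velocity of the same reparametrized curve in the chart
    \<open>c\<close>, so uniqueness of derivatives identifies them.\<close>
  have w_eq: "w s = deriv h s *\<^sub>R V (h s)" if s: "s \<in> J" for s
  proof -
    have "h s \<in> {-e<..<e}" using hJ s by (auto simp: I_def)
    then have "((\<lambda>s. X (h s)) has_vector_derivative deriv h s *\<^sub>R V (h s)) (at s)"
      using vector_diff_chain_at[of h "deriv h s" s X] h'[OF s] XV
      by (simp add: o_def has_real_derivative_iff_has_vector_derivative)
    moreover have "((\<lambda>s. X (h s)) has_vector_derivative w s) (at s)"
      using w(1)[OF s] by (rule has_vector_derivative_transform_within_open[OF _ J s])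
        (use \<gamma> hJ in blast)
    ultimately show ?thesis by (rule vector_derivative_unique_at[symmetric])
  qed
  have "0 \<in> I" using \<open>0 < e\<close> by (simp add: I_def)
  \<comment> \<open>Since \<open>h\<close> maps onto \<open>I\<close>, some parameter
    \<open>s\<close> corresponds to the initial point, where position and velocity are
    \<open>x\<close> and \<open>u\<close>.\<close>
  then obtain s where s: "s \<in> J" and hs: "h s = 0" using hJ by (metis imageE)
  define p where "p = deriv h s"
  have "((\<lambda>s. V (h s)) has_vector_derivative p *\<^sub>R acceleration (\<Gamma> c x) u) (at s)"
    using vector_diff_chain_at[of h p s V] h'[OF s] VG[of 0] \<open>0 < e\<close>
    by (simp add: o_def has_real_derivative_iff_has_vector_derivative p_def hs X0 V0)
  then have "((\<lambda>s. deriv h s *\<^sub>R V (h s)) has_vector_derivative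
      p *\<^sub>R p *\<^sub>R acceleration (\<Gamma> c x) u + deriv (deriv h) s *\<^sub>R u) (at s)"
    using has_vector_derivative_scaleR[OF h''[OF s]] by (fastforce simp: hs V0 p_def)
  then have "(w has_vector_derivative
      p *\<^sub>R p *\<^sub>R acceleration (\<Gamma> c x) u + deriv (deriv h) s *\<^sub>R u) (at s)"
    by (rule has_vector_derivative_transform_within_open[OF _ J s]) (simp add: w_eq)
  moreover have "(w has_vector_derivative p *\<^sub>R p *\<^sub>R acceleration (\<Gamma>' c x) u) (at s)"
  proof -
    have "acceleration G (p *\<^sub>R u) = p *\<^sub>R p *\<^sub>R acceleration G u" for G
      by (simp add: acceleration_def vec_eq_iff sum_distrib_left ac_simps)
    then show ?thesis using w(2)[OF s] by (simp add: w_eq[OF s] hs X0 V0 p_def)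
  qed
  ultimately have "p *\<^sub>R p *\<^sub>R acceleration (\<Gamma> c x) u + deriv (deriv h) s *\<^sub>R u
      = p *\<^sub>R p *\<^sub>R acceleration (\<Gamma>' c x) u"
    by (rule vector_derivative_unique_at)
  then have "(p * p) *\<^sub>R (acceleration (\<Gamma> c x) u - acceleration (\<Gamma>' c x) u) = (- deriv (deriv h) s) *\<^sub>R u"
    by (simp add: scaleR_diff_right eq_neg_iff_add_eq_0 algebra_simps)
  then have "(1 / (p * p)) *\<^sub>R (p * p) *\<^sub>R (acceleration (\<Gamma> c x) u - acceleration (\<Gamma>' c x) u)
      = (1 / (p * p)) *\<^sub>R (- deriv (deriv h) s) *\<^sub>R u"
    by (rule arg_cong)
  moreover have "1 / (p * p) * (p * p) = 1" using h'_nz[OF s] by (simp add: p_def)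
  ultimately have "acceleration (\<Gamma> c x) u - acceleration (\<Gamma>' c x) u
      = (1 / (p * p) * - deriv (deriv h) s) *\<^sub>R u"
    by (simp only: scaleR_scaleR scaleR_one)
  then show ?thesis ..
qed

text \<open>Polarization, by testing \<open>acceleration T u\<close> on \<open>e\<^sub>i\<close> and on \<open>e\<^sub>i \<plusminus> e\<^sub>j\<close>.\<close>

lemma acceleration_parallel_imp_delta_form:
  fixes T :: "real^'n::finite^'n^'n"
  assumes sym: "\<And>i j. T $ i $ j = T $ j $ i"
    and par: "\<And>u. \<exists>\<mu>. acceleration T u = \<mu> *\<^sub>R u"
  shows "T $ i $ j $ k = (if k = i then T $ j $ j $ j / 2 else 0) + (if k = j then T $ i $ i $ i / 2 else 0)"
proof -
  \<comment> \<open>Only \<open>s\<close> equal to 0, 1 and -1 will be needed; symmetry merges the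
    two mixed terms.\<close>
  have acc: "acceleration T (axis i 1 + s *\<^sub>R axis j 1) $ k =
      - (T $ i $ i $ k + 2 * s * T $ i $ j $ k + s * s * T $ j $ j $ k)" for i j k s
  proof -
    have "(axis i 1 + s *\<^sub>R axis j 1) $ a = (if a = i then 1 else 0) + (if a = j then s else 0)" for a
      by (simp add: axis_def)
    moreover have "(\<Sum>a\<in>UNIV. \<Sum>b\<in>UNIV. T $ a $ b $ k * ((if a = i then 1 else 0) + (if a = j then s else 0))
        * ((if b = i then 1 else 0) + (if b = j then s else 0)))
      = T $ i $ i $ k + s * T $ i $ j $ k + s * T $ j $ i $ k + s * s * T $ j $ j $ k"
      by (simp add: distrib_left distrib_right sum.distrib if_distrib[of "(*) _"] if_distrib[of "\<lambda>x. x * _"]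
          cong: if_cong)
    ultimately show ?thesis by (simp add: acceleration_def sym[of j i])
  qed
  have diag: "T $ i $ i $ k = 0" if "k \<noteq> i" for i k
  proof -
    obtain \<mu> where "acceleration T (axis i 1) = \<mu> *\<^sub>R axis i 1" using par by blast
    then have "acceleration T (axis i 1 + 0 *\<^sub>R axis i 1) $ k = \<mu> * axis i 1 $ k" by simp
    with that show ?thesis unfolding acc by (simp add: axis_def)
  qed
  show ?thesis
  proof (cases "i = j")
    case True
    then show ?thesis using diag[of k i] by auto
  next
    case False
    obtain \<mu> where \<mu>: "acceleration T (axis i 1 + 1 *\<^sub>R axis j 1) = \<mu> *\<^sub>R (axis i 1 + 1 *\<^sub>R axis j 1)"
      using par by blast
    obtain \<nu> where \<nu>: "acceleration T (axis i 1 + (-1) *\<^sub>R axis j 1) = \<nu> *\<^sub>R (axis i 1 + (-1) *\<^sub>R axis j 1)"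
      using par by blast
    have \<mu>k: "- (T $ i $ i $ k + 2 * 1 * T $ i $ j $ k + 1 * 1 * T $ j $ j $ k) =
        \<mu> * (axis i 1 $ k + axis j 1 $ k)" for k
      unfolding acc[symmetric] \<mu> by simp
    have \<nu>k: "- (T $ i $ i $ k + 2 * (-1) * T $ i $ j $ k + (-1) * (-1) * T $ j $ j $ k) =
        \<nu> * (axis i 1 $ k - axis j 1 $ k)" for k
      unfolding acc[symmetric] \<nu> by simp
    \<comment> \<open>Put \<open>a = T $ i $ i $ i\<close>, \<open>b = T $ j $ j $ j\<close>,
      \<open>p = T $ i $ j $ i\<close>, \<open>q = T $ i $ j $ j\<close>. Components
      \<open>i\<close> and \<open>j\<close> give \<open>a + 2 * p = b + 2 * q\<close> and
      \<open>a - 2 * p = 2 * q - b\<close>, so \<open>p = b / 2\<close> and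
      \<open>q = a / 2\<close>. Any other component of \<open>T $ i $ j\<close> vanishes.\<close>
    show ?thesis
      using \<mu>k[of i] \<mu>k[of j] \<mu>k[of k] \<nu>k[of i] \<nu>k[of j] False diag[of i j] diag[of j i] diag[of k i] diag[of k j]
      by (auto simp: axis_def)
  qed
qed

section \<open>Invariance of the weighted covariant derivative\<close>

lemma nabla_eq_of_projective_change:
  fixes G G' :: "real^'n::finite^'n^'n" and b :: "'n \<Rightarrow> real"
  assumes G: "\<And>i j k. G $ i $ j $ k - G' $ i $ j $ k = (if k = i then b j else 0) + (if k = j then b i else 0)"
    and w: "w * (real CARD('n) + 1) = - 2"
  shows "nabla w G \<beta> x = nabla w G' \<beta> x"
proof -
  have G': "G $ i $ j $ k = G' $ i $ j $ k + ((if k = i then b j else 0) + (if k = j then b i else 0))" for i j k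
    using G[of i j k] by linarith
  have "nabla_component w G \<beta> x i j = nabla_component w G' \<beta> x i j + (b i * \<beta> x $ j - b j * \<beta> x $ i)" for i j
  proof -
    have "(\<Sum>k\<in>UNIV. G $ i $ j $ k * \<beta> x $ k) =
        (\<Sum>k\<in>UNIV. G' $ i $ j $ k * \<beta> x $ k) + (b j * \<beta> x $ i + b i * \<beta> x $ j)"
      by (simp add: G' distrib_right sum.distrib if_distrib[of "\<lambda>x. x * _"] cong: if_cong)
    \<comment> \<open>In the trace, the first delta contributes \<open>b i\<close> once and the
      second contributes it for every \<open>k\<close>.\<close>
    moreover have "(\<Sum>k\<in>UNIV. G $ i $ k $ k) = (\<Sum>k\<in>UNIV. G' $ i $ k $ k) + (real CARD('n) + 1) * b i"
      by (simp add: G' sum.distrib algebra_simps)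
    moreover have "w * ((real CARD('n) + 1) * b i) * \<beta> x $ j = - 2 * b i * \<beta> x $ j"
      by (simp add: w flip: mult.assoc)
    ultimately show ?thesis by (simp add: nabla_component_def algebra_simps)
  qed
  \<comment> \<open>The correction \<open>b i * \<beta> x $ j - b j * \<beta> x $ i\<close> is skew,
    so the symmetrization in \<open>nabla\<close> removes it.\<close>
  then show ?thesis by (simp add: nabla_def vec_eq_iff)
qed

theorem theorem3p3p1:
  fixes A :: "('a::{t2_space,second_countable_topology}, 'n::finite) chart set"
    and l :: nat
    and D :: "('a, 'n) chart \<Rightarrow> real^'n \<Rightarrow> (real^'n) set"
    and g g' :: "('a, 'n) chart \<Rightarrow> real^'n \<Rightarrow> real^'n^'n"
    and \<Gamma> \<Gamma>' :: "('a, 'n) christoffel"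
    and W :: "'a set"
    and \<theta> :: "('a, 'n) chart \<Rightarrow> real^'n \<Rightarrow> real^'n"
  assumes "l \<ge> 1"
    and "contact_manifold A l D"
    and "pseudo_riemannian_metric A g" and "pseudo_riemannian_metric A g'"
    and "levi_civita A g \<Gamma>" and "levi_civita A g' \<Gamma>'"
    and "projectively_equivalent A \<Gamma> \<Gamma>'"
    and "contact_form_on A l D W \<theta>"
  shows "\<forall>c\<in>A. \<forall>x\<in>cimage c W.
           nabla_contact_tensor l \<Gamma> \<theta> c x = nabla_contact_tensor l \<Gamma>' \<theta> c x"
proof (intro ballI)
  fix c x assume c: "c \<in> A" and "x \<in> cimage c W"
  then have x: "x \<in> coord c ` cdom c" by (auto simp: cimage_def)
  have A: "smooth_atlas A" and dim: "CARD('n) = 2 * l + 1"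
    using assms(2) by (auto simp: contact_manifold_def)
  have \<Gamma>: "affine_connection A \<Gamma>"
    and sym: "symmetric_connection A \<Gamma>" "symmetric_connection A \<Gamma>'"
    using assms(5,6) by (auto simp: levi_civita_def)
  define T where "T = \<Gamma> c x - \<Gamma>' c x"
  have "T $ i $ j = T $ j $ i" for i j
  proof -
    have "\<Gamma> c x $ i $ j = \<Gamma> c x $ j $ i" "\<Gamma>' c x $ i $ j = \<Gamma>' c x $ j $ i"
      using sym c x unfolding symmetric_connection_def by blast+
    then show ?thesis by (simp add: T_def)
  qed
  moreover have "acceleration T u = acceleration (\<Gamma> c x) u - acceleration (\<Gamma>' c x) u" for u
    by (simp add: T_def acceleration_def vec_eq_iff left_diff_distrib sum_subtractf)
  then have "\<exists>\<mu>. acceleration T u = \<mu> *\<^sub>R u" for u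
    using projectively_equivalent_acceleration[OF A \<Gamma> assms(7) c x] by simp
  ultimately have T: "\<Gamma> c x $ i $ j $ k - \<Gamma>' c x $ i $ j $ k =
      (if k = i then T $ j $ j $ j / 2 else 0) + (if k = j then T $ i $ i $ i / 2 else 0)" for i j k
    using acceleration_parallel_imp_delta_form[of T i j k] by (simp add: T_def)
  \<comment> \<open>The dimension \<open>2 * l + 1\<close> plus one is \<open>2 * (l + 1)\<close>,
    so the weight of the contact tensor is exactly the one that makes the correction skew.\<close>
  have "- 1 / (real l + 1) * (real CARD('n) + 1) = - 2"
    by (simp add: dim field_simps)
  with T show "nabla_contact_tensor l \<Gamma> \<theta> c x = nabla_contact_tensor l \<Gamma>' \<theta> c x"
    unfolding nabla_contact_tensor_def by (rule nabla_eq_of_projective_change)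
qed

end
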